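(* Let $\{f_n\}_{n\ge1}$ be a sequence of $\tfrac12$-level minimizers, i.e. for each $n$, $f_n\in\mathcal{P}_n(\overline{\mathbb{D}})$ and $m(\Lambda_{f_n}(\tfrac12))=\kappa_n(\overline{\mathbb{D}},\tfrac12)$. Then $\{f_n\}$ is a normal family of holomorphic functions in the open unit disc $\mathbb{D}$.
   Context: $\mathcal{P}_n(\overline{\mathbb{D}})$ is the set of monic complex polynomials of degree $n$ all of whose zeros lie in the closed unit disc $\overline{\mathbb{D}}$. For a polynomial $p$ and $t>0$, $\Lambda_p(t)=\{z\in\mathbb{C}:|p(z)|\le t\}$; $m$ is Lebesgue measure on $\mathbb{C}$; and $\kappa_n(\overline{\mathbb{D}},t)=\inf\{m(\Lambda_p(t)):p\in\mathcal{P}_n(\overline{\mathbb{D}})\}$. Normal means that every sequence from the family has a subsequence converging uniformly on compact subsets of $\mathbb{D}$ to a holomorphic function. *)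

theory Defs
  imports "HOL-Complex_Analysis.Complex_Analysis"
begin

definition monic_polys :: "complex set \<Rightarrow> nat \<Rightarrow> complex poly set" where
  "monic_polys K n = {p. lead_coeff p = 1 \<and> degree p = n \<and> (\<forall>z. poly p z = 0 \<longrightarrow> z \<in> K)}"

definition lemniscate :: "complex poly \<Rightarrow> real \<Rightarrow> complex set" where
  "lemniscate p t = {z. cmod (poly p z) \<le> t}"

(* Areas are extended nonnegative reals, so an unbounded sublevel set (which occurs only
   for constant p) has infinite area rather than the default value 0. *)
definition min_area :: "complex set \<Rightarrow> nat \<Rightarrow> real \<Rightarrow> ennreal" where
  "min_area K n t = (INF p \<in> monic_polys K n. emeasure lebesgue (lemniscate p t))"

definition level_minimizer :: "complex set \<Rightarrow> nat \<Rightarrow> real \<Rightarrow> complex poly \<Rightarrow> bool" where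
  "level_minimizer K n t p \<longleftrightarrow>
     p \<in> monic_polys K n \<and> emeasure lebesgue (lemniscate p t) = min_area K n t"

(* The limit is required to be a finite-valued holomorphic function: locally uniform
   divergence to infinity is not allowed. *)
definition normal_family_on :: "complex set \<Rightarrow> (complex \<Rightarrow> complex) set \<Rightarrow> bool" where
  "normal_family_on S F \<longleftrightarrow>
     (\<forall>g :: nat \<Rightarrow> complex \<Rightarrow> complex. (\<forall>k. g k \<in> F) \<longrightarrow>
        (\<exists>r h. strict_mono r \<and> h holomorphic_on S \<and>
           (\<forall>C. compact C \<and> C \<subseteq> S \<longrightarrow> uniform_limit C (\<lambda>k. g (r k)) h sequentially)))"

end

theory Submission
  imports Defs "HOL-Computational_Algebra.Fundamental_Theorem_Algebra"
begin

text \<open>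
  Comparison with \<open>z^n - 1\<close>, whose sublevel set lies in an annulus of width \<open>2/n\<close>, shows that the
  minimal area is at most \<open>4 * pi / n\<close>. This bound alone forces local boundedness. Let \<open>a\<^sub>i\<close> be the
  zeros of \<open>p\<close> and \<open>q z = (\<Prod>i. 1 - cnj a\<^sub>i * z)\<close>. On the disc \<open>q\<close> has no zeros, \<open>q 0 = 1\<close> and
  \<open>|p| \<le> |q|\<close>, so \<open>u = ln |q|\<close> is harmonic with \<open>u 0 = 0\<close>, and \<open>{u \<le> - ln 2}\<close> has area \<open>O(1/n)\<close>.
  Since \<open>|q (t z)| \<le> t^n |q z|\<close> for \<open>t \<ge> 1\<close>, a point with \<open>u z = - A\<close> has \<open>u \<le> - ln 2\<close> on a radial
  segment of length comparable to \<open>A/n\<close>. Hence the negative part of \<open>u\<close> has bounded integral over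
  every smaller disc; by the mean value property so has the positive part, and \<open>u\<close> is bounded
  above on compact sets. Montel's theorem concludes.
\<close>

section \<open>Rotation invariance of Lebesgue measure on the complex plane\<close>

text \<open>The coordinate map pulls boxes back to boxes with the same side lengths, and boxes
  determine the measure. This carries invariance under orthogonal maps of \<open>real^2\<close> over
  to the complex plane.\<close>

lemma distr_lborel_vec2_complex:
  "distr lborel borel (\<lambda>x::real^2. Complex (x $ 1) (x $ 2)) = lborel"
proof (rule lborel_eqI[symmetric])
  fix l u :: complex
  assume le: "\<And>b. b \<in> Basis \<Longrightarrow> l \<bullet> b \<le> u \<bullet> b"
  let ?T = "\<lambda>x::real^2. Complex (x $ 1) (x $ 2)"
  have meas: "?T \<in> borel_measurable borel"
    by (intro borel_measurable_continuous_onI) (auto simp: complex_eq_iff Complex_eq intro!: continuous_intros)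
  have vi: "?T -` box l u = box (vector [Re l, Im l]) (vector [Re u, Im u])"
    by (auto simp: in_box_complex_iff mem_box_cart forall_2)
  have le': "Re l \<le> Re u" "Im l \<le> Im u"
    using le[of 1] le[of \<i>] by (auto simp: Basis_complex_def inner_complex_def)
  have "emeasure lborel (box (vector [Re l, Im l] :: real^2) (vector [Re u, Im u]))
      = ennreal ((Re u - Re l) * (Im u - Im l))"
    using le' by (auto simp: emeasure_lborel_box_eq Basis_vec_def UNIV_2 inner_axis axis_eq_axis)
  then show "emeasure (distr lborel borel ?T) (box l u) = (\<Prod>b\<in>Basis. (u - l) \<bullet> b)"
    using meas le' by (simp add: emeasure_distr vi Basis_complex_def inner_complex_def)
qed simp

text \<open>In coordinates, multiplication by \<open>cnj c\<close> is an orthogonal map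
  \<open>R\<close> of \<open>real^2\<close>. As \<open>cnj c\<close> inverts \<open>c\<close>, the
  preimage of a box under multiplication by \<open>c\<close> is its image under \<open>R\<close>, so
  its area is unchanged.\<close>

lemma distr_lborel_rotation:
  fixes c :: complex
  assumes c: "cmod c = 1"
  shows "distr lborel borel ((*) c) = lborel"
proof (rule lborel_eqI[symmetric])
  fix l u :: complex
  assume le: "\<And>b. b \<in> Basis \<Longrightarrow> l \<bullet> b \<le> u \<bullet> b"
  define T where "T = (\<lambda>x::real^2. Complex (x $ 1) (x $ 2))"
  define V where "V = (\<lambda>z. vector [Re z, Im z] :: real^2)"
  define R where "R = (\<lambda>x. V (cnj c * T x))"
  have cc: "c * cnj c = 1"
    using c by (simp add: complex_norm_square[symmetric])
  have TV: "T (V z) = z" and VT: "V (T x) = x" for z x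
    by (simp_all add: T_def V_def vec_eq_iff forall_2)
  have nT: "norm (T x) = norm x" for x
    by (simp add: T_def norm_vec_def L2_set_def UNIV_2 complex_norm)
  have nV: "norm (V z) = norm z" for z
    by (metis TV nT)
  have Tmeas: "T \<in> borel_measurable borel"
    unfolding T_def
    by (intro borel_measurable_continuous_onI) (auto simp: Complex_eq intro!: continuous_intros)
  have linR: "linear R"
    by (rule linearI) (auto simp: R_def V_def T_def vec_eq_iff forall_2 algebra_simps)
  have R: "orthogonal_transformation R"
    unfolding orthogonal_transformation using linR c by (simp add: R_def nV nT norm_mult)
  have vi: "T -` ((*) c -` box l u) = R ` (T -` box l u)"
  proof (intro equalityI subsetI)
    fix x assume "x \<in> T -` ((*) c -` box l u)"
    moreover have "x = R (V (c * T x))"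
    proof -
      have "cnj c * (c * T x) = T x"
        using cc by (simp only: mult.assoc[symmetric] mult.commute[of "cnj c"] mult_1_left)
      then show ?thesis by (simp only: R_def TV VT)
    qed
    ultimately show "x \<in> R ` (T -` box l u)"
      by (auto simp: TV intro!: image_eqI[of _ _ "V (c * T x)"])
  qed (auto simp: R_def TV cc mult.assoc[symmetric])
  have box: "emeasure lborel (T -` box l u) = emeasure lborel (box l u)"
    using Tmeas by (subst distr_lborel_vec2_complex[symmetric]) (simp add: emeasure_distr T_def)
  have Tbox: "T -` box l u \<in> sets borel"
    using measurable_sets[OF Tmeas, of "box l u"] by simp
  then have lm: "T -` box l u \<in> lmeasurable"
    using box by (intro fmeasurableI) (auto simp: emeasure_lborel_box_eq less_top[symmetric])
  have "emeasure (distr lborel borel ((*) c)) (box l u) = emeasure lborel ((*) c -` box l u)"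
    by (simp add: emeasure_distr)
  also have "\<dots> = emeasure lborel (T -` ((*) c -` box l u))"
  proof -
    have "(*) c -` box l u \<in> sets borel"
      using measurable_sets[of "(*) c" borel borel "box l u"] by simp
    then show ?thesis
      using Tmeas by (subst distr_lborel_vec2_complex[symmetric]) (simp add: emeasure_distr T_def)
  qed
  also have "\<dots> = emeasure lebesgue (R ` (T -` box l u))"
  proof -
    have "T -` ((*) c -` box l u) \<in> sets borel"
      using measurable_sets[OF Tmeas, of "(*) c -` box l u"]
        measurable_sets[of "(*) c" borel borel "box l u"] by simp
    then show ?thesis
      by (simp flip: vi)
  qed
  also have "\<dots> = emeasure lebesgue (T -` box l u)"
    using measure_orthogonal_image[OF R lm] measurable_orthogonal_image[OF R lm] lm
    by (simp add: emeasure_eq_measure2)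
  also have "\<dots> = emeasure lborel (box l u)"
    using Tbox box by simp
  also have "\<dots> = (\<Prod>b\<in>Basis. (u - l) \<bullet> b)"
    using le by (simp add: emeasure_lborel_box_eq)
  finally show "emeasure (distr lborel borel ((*) c)) (box l u) = (\<Prod>b\<in>Basis. (u - l) \<bullet> b)" .
qed simp

section \<open>The area mean value property of holomorphic functions\<close>

text \<open>The rotation by \<open>w\<close> with \<open>w ^ k = -1\<close> preserves the disc and
  the measure but changes the sign of the integrand, so the integral equals its own
  negative.\<close>

lemma integral_cball_power_eq_0:
  assumes "k > 0"
  shows "(LINT z:cball 0 R|lborel. z ^ k :: complex) = 0"
proof -
  define w where "w = cis (pi / k)"
  have w: "cmod w = 1" "w ^ k = -1"
    using assms Complex.DeMoivre[of "pi / k" k] by (simp_all add: w_def)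
  define f where "f = (\<lambda>z::complex. indicator (cball 0 R) z *\<^sub>R z ^ k)"
  have [measurable]: "f \<in> borel_measurable borel"
    unfolding f_def by (intro borel_measurable_continuous_on_indicator continuous_intros) auto
  have "integral\<^sup>L lborel f = integral\<^sup>L (distr lborel borel ((*) w)) f"
    using distr_lborel_rotation[OF w(1)] by simp
  also have "\<dots> = integral\<^sup>L lborel (\<lambda>z. f (w * z))"
    by (rule integral_distr) auto
  also have "(\<lambda>z. f (w * z)) = (\<lambda>z. - f z)"
    using w by (auto simp: f_def fun_eq_iff norm_mult power_mult_distrib indicator_def)
  finally show ?thesis
    by (simp add: f_def set_lebesgue_integral_def)
qed

text \<open>The power series is integrated term by term; by the preceding symmetry only the constant
  term survives.\<close>

lemma holomorphic_mean_value_cball_0: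
  fixes f :: "complex \<Rightarrow> complex"
  assumes f: "f holomorphic_on ball 0 S" and R: "0 < R" "R < S"
  shows "(LINT z:cball 0 R|lborel. f z) = pi * R\<^sup>2 * f 0"
proof -
  define a where "a = (\<lambda>n. (deriv ^^ n) f 0 / fact n)"
  have sm: "(\<lambda>n. a n * z ^ n) sums f z" if "z \<in> ball 0 S" for z
    using holomorphic_power_series[OF f that] by (simp add: a_def)
  define h where "h = (\<lambda>n z. indicator (cball 0 R) z *\<^sub>R (a n * z ^ n))"
  have int: "integrable lborel (h n)" for n
    unfolding h_def by (intro borel_integrable_compact continuous_intros) auto
  \<comment> \<open>Convergence at a radius strictly between \<open>R\<close> and \<open>S\<close>
    gives absolute convergence at \<open>R\<close>, which dominates all terms on the disc and
    justifies exchanging sum and integral.\<close>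
  define r where "r = (R + S) / 2"
  have summ: "summable (\<lambda>n. norm (a n * of_real R ^ n))"
  proof (rule powser_insidea)
    have r: "0 < r" "r < S" "R < r" using R by (auto simp: r_def)
    show "summable (\<lambda>n. a n * of_real r ^ n)"
      using sm[of "of_real r"] r by (auto simp: sums_iff)
    show "norm (of_real R :: complex) < norm (of_real r :: complex)"
      using R r by simp
  qed
  have bound: "norm (h n z) \<le> norm (a n * of_real R ^ n)" for n z
    using R by (auto simp: h_def indicator_def norm_mult norm_power intro!: mult_left_mono power_mono)
  have hsum: "(\<Sum>n. h n z) = indicator (cball 0 R) z *\<^sub>R f z" for z
    using sm[of z] R by (auto simp: h_def indicator_def sums_iff)
  have vol: "measure lborel (cball (0::complex) R) = pi * R\<^sup>2"
    using R by (simp add: content_cball eval_unit_ball_vol power2_eq_square)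
  have hint: "integral\<^sup>L lborel (h n) = (if n = 0 then pi * R\<^sup>2 * f 0 else 0)" for n
  proof (cases "n = 0")
    case True
    have "integral\<^sup>L lborel (h 0) = (LINT z|lborel. indicator (cball (0::complex) R) z :: real) *\<^sub>R f 0"
      unfolding h_def a_def using emeasure_lborel_cball_finite[of "0::complex" R]
      by (subst integral_scaleR_left[symmetric]) auto
    then show ?thesis
      using True vol by (simp add: scaleR_conv_of_real)
  next
    case False
    have "integral\<^sup>L lborel (h n) = (LINT z|lborel. a n * (indicator (cball 0 R) z *\<^sub>R z ^ n))"
      by (simp add: h_def)
    also have "\<dots> = a n * (LINT z:cball 0 R|lborel. z ^ n)"
      unfolding set_lebesgue_integral_def by (rule integral_mult_right_zero)
    finally show ?thesis
      using integral_cball_power_eq_0[of n R] False by simp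
  qed
  have nint: "(LINT z|lborel. norm (h n z)) \<le> pi * R\<^sup>2 * norm (a n * of_real R ^ n)" for n
  proof -
    have "(LINT z|lborel. norm (h n z)) \<le> (LINT z|lborel. indicator (cball (0::complex) R) z *\<^sub>R norm (a n * of_real R ^ n))"
    proof (rule integral_mono)
      show "integrable lborel (\<lambda>z. norm (h n z))"
        using int by (rule integrable_norm)
      show "integrable lborel (\<lambda>z::complex. indicator (cball 0 R) z *\<^sub>R norm (a n * of_real R ^ n))"
        by (intro borel_integrable_compact continuous_intros) auto
      show "norm (h n z) \<le> indicator (cball 0 R) z *\<^sub>R norm (a n * of_real R ^ n)" for z
        using bound[of n z] by (auto simp: h_def indicator_def)
    qed
    also have "\<dots> = pi * R\<^sup>2 * norm (a n * of_real R ^ n)"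
      using vol by simp
    finally show ?thesis .
  qed
  have "(\<lambda>n. integral\<^sup>L lborel (h n)) sums (LINT z|lborel. (\<Sum>n. h n z))"
  proof (rule sums_integral[OF int])
    show "AE z in lborel. summable (\<lambda>n. norm (h n z))"
      using bound by (intro AE_I2 summable_comparison_test'[OF summ]) auto
    show "summable (\<lambda>n. LINT z|lborel. norm (h n z))"
      using nint by (intro summable_comparison_test'[OF summable_mult[OF summ, of "pi * R\<^sup>2"]]) auto
  qed
  moreover have "(\<lambda>n. integral\<^sup>L lborel (h n)) sums (pi * R\<^sup>2 * f 0)"
    unfolding hint by (rule sums_If_finite_set[of "{0}", simplified, THEN sums_cong[THEN iffD1, rotated]]) auto
  ultimately show ?thesis
    unfolding hsum set_lebesgue_integral_def using sums_unique2 by blast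
qed

lemma holomorphic_mean_value_cball:
  fixes f :: "complex \<Rightarrow> complex"
  assumes f: "f holomorphic_on ball c S" and R: "0 < R" "R < S"
  shows "(LINT z:cball c R|lborel. f z) = pi * R\<^sup>2 * f c"
proof -
  have "(LINT z:cball c R|lborel. f z) = (LINT z|distr lborel borel ((+) c). indicator (cball c R) z *\<^sub>R f z)"
    by (simp add: set_lebesgue_integral_def lborel_distr_plus)
  also have "\<dots> = (LINT z|lborel. indicator (cball c R) (c + z) *\<^sub>R f (c + z))"
  proof (rule integral_distr)
    have "continuous_on (cball c R) f"
      using R by (intro holomorphic_on_imp_continuous_on holomorphic_on_subset[OF f]) auto
    then show "(\<lambda>z. indicator (cball c R) z *\<^sub>R f z) \<in> borel_measurable borel"
      by (intro borel_measurable_continuous_on_indicator) auto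
  qed auto
  also have "\<dots> = (LINT z:cball 0 R|lborel. f (c + z))"
    unfolding set_lebesgue_integral_def
    by (intro Bochner_Integration.integral_cong) (auto simp: indicator_def dist_norm)
  also have "\<dots> = pi * R\<^sup>2 * f (c + 0)"
    by (rule holomorphic_mean_value_cball_0[OF _ R])
       (auto intro!: holomorphic_on_compose_gen[OF _ f, unfolded o_def] holomorphic_intros simp: dist_norm)
  finally show ?thesis by simp
qed

section \<open>Inequalities for a single linear factor\<close>

text \<open>The difference of the squared sides is exactly
  \<open>(t - 1) * (t + 1 - 2 * t * Re w)\<close>. Taking the product over all zeros gives the
  radial growth condition.\<close>

lemma norm_one_minus_scaleR_le:
  fixes w :: complex
  assumes t: "1 \<le> t" and tw: "norm (t *\<^sub>R w) \<le> 1"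
  shows "norm (1 - t *\<^sub>R w) \<le> t * norm (1 - w)"
proof -
  have "t * Re w \<le> 1"
    using complex_Re_le_cmod[of "t *\<^sub>R w"] tw by simp
  then have "0 \<le> (t - 1) * (t + 1 - 2 * t * Re w)"
    using t by (intro mult_nonneg_nonneg) auto
  then have "(norm (1 - t *\<^sub>R w))\<^sup>2 \<le> (t * norm (1 - w))\<^sup>2"
    unfolding power_mult_distrib cmod_power2 by (simp add: algebra_simps power2_eq_square)
  then show ?thesis
    using t by (simp add: power2_le_iff_abs_le)
qed

text \<open>The difference of the squared sides is exactly
  \<open>(1 - (norm a)\<^sup>2) * (1 - (norm z)\<^sup>2)\<close>.\<close>

lemma norm_diff_le_norm_one_minus_cnj_mult:
  assumes "norm a \<le> 1" "norm z \<le> 1"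
  shows "norm (z - a) \<le> norm (1 - cnj a * z)"
proof -
  have "0 \<le> (1 - (norm a)\<^sup>2) * (1 - (norm z)\<^sup>2)"
    using assms by (intro mult_nonneg_nonneg) (simp_all add: power_le_one)
  then have "(norm (z - a))\<^sup>2 \<le> (norm (1 - cnj a * z))\<^sup>2"
    unfolding cmod_power2 by (simp add: algebra_simps power2_eq_square)
  then show ?thesis
    by (simp add: power2_le_iff_abs_le)
qed

section \<open>From small area of a sublevel set to a bounded negative part\<close>

lemma emeasure_vimage_scaleR_le:
  fixes E :: "'a::euclidean_space set"
  assumes t: "1 \<le> t" and E: "E \<in> sets borel"
  shows "emeasure lborel {x. t *\<^sub>R x \<in> E} \<le> emeasure lborel E"
proof -
  have eq: "{x. t *\<^sub>R x \<in> E} = (\<lambda>x. (1 / t) *\<^sub>R x + 0) ` E"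
    using t by (force simp: image_iff intro: bexI[of _ "t *\<^sub>R _"])
  have "{x. t *\<^sub>R x \<in> E} \<in> sets borel"
    using measurable_sets[of "\<lambda>x. t *\<^sub>R x" borel borel E] E by (simp add: vimage_def)
  then have "emeasure lborel {x. t *\<^sub>R x \<in> E} = emeasure lebesgue {x. t *\<^sub>R x \<in> E}"
    by simp
  also have "\<dots> = ennreal (\<bar>1 / t\<bar> ^ DIM('a)) * emeasure lebesgue E"
    unfolding eq by (simp only: emeasure_lebesgue_affine) 
  also have "\<dots> \<le> 1 * emeasure lebesgue E"
    using t by (intro mult_right_mono) (auto simp: power_le_one)
  finally show ?thesis
    using E by simp
qed

text \<open>
  If \<open>Re g\<close> is far below \<open>- ln 2\<close> at \<open>z\<close>, the growth condition keeps it below \<open>- ln 2\<close> on a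
  whole radial segment starting at \<open>z\<close>; averaging over the dilations \<open>t\<close> therefore converts the
  depth of \<open>Re g\<close> into area of the sublevel set.
\<close>
lemma integral_neg_part_le:
  fixes g :: "complex \<Rightarrow> complex" and n :: nat and \<rho> M C :: real
  assumes g: "g holomorphic_on ball 0 1" and n: "n \<ge> 1" and \<rho>: "0 < \<rho>" "\<rho> < 1"
    and growth: "\<And>t z. 1 \<le> t \<Longrightarrow> norm (t *\<^sub>R z) < 1 \<Longrightarrow> Re (g (t *\<^sub>R z)) \<le> Re (g z) + n * ln t"
    and lower: "\<And>z. norm z \<le> \<rho> \<Longrightarrow> - (n * M) \<le> Re (g z)"
    and M: "0 < M" and C: "0 \<le> C"
    and area: "emeasure lborel {z \<in> ball 0 1. Re (g z) \<le> - ln 2} \<le> ennreal (C / n)"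
  shows "(LINT z:cball 0 \<rho>|lborel. max 0 (- Re (g z))) \<le> pi * \<rho>\<^sup>2 * ln 2 + M * C"
proof -
  define E where "E = {z \<in> ball 0 1. Re (g z) \<le> - ln 2}"
  define s where "s = (\<lambda>z. max 0 (- Re (g z) - ln 2))"
  \<comment> \<open>The choice of \<open>k\<close> gives \<open>k * M \<le> d / 2\<close>, so every
    dilation by \<open>t \<le> 1 + k * M\<close> keeps \<open>cball 0 \<rho>\<close> inside the open
    unit disc. The cap \<open>k \<le> 1\<close> serves the estimate of \<open>ln t\<close>
    below.\<close>
  define d where "d = 1 / \<rho> - 1"
  define k where "k = min 1 (d / (2 * M))"
  have d: "0 < d"
    using \<rho> by (simp add: d_def)
  then have k: "0 < k" "k \<le> 1"
    using M by (auto simp: k_def)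
  have "k * M \<le> d / (2 * M) * M"
    using M by (intro mult_right_mono) (auto simp: k_def)
  also have "\<dots> < d"
    using M d by simp
  finally have "1 + k * M < 1 / \<rho>"
    by (simp add: d_def)
  then have kM: "(1 + k * M) * \<rho> < 1"
    using \<rho> by (simp add: field_simps)
  have contg: "continuous_on (cball 0 \<rho>) g"
    using \<rho> by (intro holomorphic_on_imp_continuous_on holomorphic_on_subset[OF g]) auto
  have E [measurable]: "E \<in> sets borel"
  proof -
    have [measurable]: "(\<lambda>z. indicator (ball 0 1) z *\<^sub>R Re (g z)) \<in> borel_measurable borel"
      using holomorphic_on_imp_continuous_on[OF g]
      by (intro borel_measurable_continuous_on_indicator continuous_intros) auto
    have "E = {z. z \<in> ball 0 1 \<and> indicator (ball 0 1) z *\<^sub>R Re (g z) \<le> - ln 2}"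
      by (auto simp: E_def)
    also have "\<dots> \<in> sets borel"
      by measurable
    finally show ?thesis .
  qed
  have [measurable]: "(\<lambda>z. indicator (cball 0 \<rho>) z *\<^sub>R s z) \<in> borel_measurable borel"
    unfolding s_def using contg by (intro borel_measurable_continuous_on_indicator continuous_intros) auto
  \<comment> \<open>For fixed \<open>z\<close>, all \<open>t\<close> between \<open>1\<close> and
    \<open>1 + k * (s z / n)\<close> send \<open>z\<close> into \<open>E\<close>; the left-hand side
    is the length of this interval.\<close>
  have slice: "ennreal (indicator (cball 0 \<rho>) z *\<^sub>R s z) * ennreal (k / n)
      \<le> (\<integral>\<^sup>+t. indicator {1..1 + k * M} t * indicator E (t *\<^sub>R z) \<partial>lborel)" for z
  proof (cases "z \<in> cball 0 \<rho> \<and> 0 < s z")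
    case True
    then have z: "norm z \<le> \<rho>" and s: "0 < s z" by auto
    have sz: "s z = - Re (g z) - ln 2" using s by (auto simp: s_def)
    have "s z \<le> n * M"
      using lower[OF z] sz ln_gt_zero[of "2::real"] by linarith
    then have snM: "s z / n \<le> M" using n by (simp add: field_simps)
    \<comment> \<open>Here \<open>n * ln t \<le> n * (t - 1) \<le> s z\<close>, so the growth
      condition raises \<open>Re (g z) = - s z - ln 2\<close> to at most
      \<open>- ln 2\<close>.\<close>
    have "t *\<^sub>R z \<in> E" if t: "1 \<le> t" "t \<le> 1 + k * (s z / n)" for t
    proof -
      have "k * (s z / n) \<le> k * M" using snM k by (intro mult_left_mono) auto
      then have "t * norm z \<le> (1 + k * M) * \<rho>"
        using t z k M by (intro mult_mono) auto
      then have nt: "norm (t *\<^sub>R z) < 1" using t kM by simp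
      have "ln t \<le> t - 1" using t by (intro ln_le_minus_one) auto
      also have "\<dots> \<le> 1 * (s z / n)"
        using t(2) mult_right_mono[OF k(2), of "s z / n"] s n by simp
      finally have "n * ln t \<le> s z" using n by (simp add: field_simps)
      then show ?thesis
        using growth[OF t(1) nt] nt sz by (simp add: E_def)
    qed
    then have "(\<integral>\<^sup>+t. indicator {1..1 + k * (s z / n)} t \<partial>lborel)
        \<le> (\<integral>\<^sup>+t. indicator {1..1 + k * M} t * indicator E (t *\<^sub>R z) \<partial>lborel)"
      using mult_left_mono[OF snM, of k] k by (intro nn_integral_mono) (auto simp: indicator_def)
    moreover have "(\<integral>\<^sup>+t. indicator {1..1 + k * (s z / n)} t \<partial>lborel) = ennreal (k * (s z / n))"
      using k s by (subst nn_integral_indicator) auto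
    ultimately show ?thesis
      using True k s by (simp add: ennreal_mult'[symmetric] mult_ac)
  next
    case False
    then have "indicator (cball 0 \<rho>) z *\<^sub>R s z = 0"
      by (auto simp: indicator_def s_def)
    then show ?thesis by (simp only: ennreal_0 mult_zero_left zero_le)
  qed
  \<comment> \<open>Integrating the slices over \<open>z\<close> and exchanging the integrals
    leaves, for each \<open>t\<close>, the area of a contracted copy of \<open>E\<close>, which is
    at most \<open>C / n\<close>. The range of \<open>t\<close> has length \<open>k * M\<close>, so
    the common factor \<open>k / n\<close> cancels and the bound \<open>M * C\<close> is free of
    \<open>n\<close>.\<close>
  have "(\<integral>\<^sup>+z. ennreal (indicator (cball 0 \<rho>) z *\<^sub>R s z) \<partial>lborel) * ennreal (k / n)
      = (\<integral>\<^sup>+z. ennreal (indicator (cball 0 \<rho>) z *\<^sub>R s z) * ennreal (k / n) \<partial>lborel)"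
    by (rule nn_integral_multc[symmetric]) measurable
  also have "\<dots> \<le> (\<integral>\<^sup>+z. \<integral>\<^sup>+t. indicator {1..1 + k * M} t * indicator E (t *\<^sub>R z) \<partial>lborel \<partial>lborel)"
    by (intro nn_integral_mono slice)
  also have "\<dots> = (\<integral>\<^sup>+t. \<integral>\<^sup>+z. indicator {1..1 + k * M} t * indicator E (t *\<^sub>R z) \<partial>lborel \<partial>lborel)"
    by (rule lborel_pair.Fubini') measurable
  also have "\<dots> \<le> (\<integral>\<^sup>+t. ennreal (C / n) * indicator {1..1 + k * M} t \<partial>lborel)"
  proof (rule nn_integral_mono)
    fix t :: real
    show "(\<integral>\<^sup>+z. indicator {1..1 + k * M} t * indicator E (t *\<^sub>R z) \<partial>lborel)
        \<le> ennreal (C / n) * indicator {1..1 + k * M} t"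
    proof (cases "t \<in> {1..1 + k * M}")
      case True
      have "{z. t *\<^sub>R z \<in> E} \<in> sets borel" by measurable
      moreover have "(\<lambda>z. indicator E (t *\<^sub>R z) :: ennreal) = indicator {z. t *\<^sub>R z \<in> E}"
        by (auto simp: fun_eq_iff indicator_def)
      ultimately have "(\<integral>\<^sup>+z. indicator E (t *\<^sub>R z) \<partial>lborel) = emeasure lborel {z. t *\<^sub>R z \<in> E}"
        by simp
      also have "\<dots> \<le> ennreal (C / n)"
        using emeasure_vimage_scaleR_le[OF _ E, of t] True area[folded E_def] by (auto intro: order_trans)
      finally show ?thesis using True by simp
    qed simp
  qed
  also have "\<dots> = ennreal (M * C) * ennreal (k / n)"
    using k M C by (simp add: nn_integral_cmult ennreal_mult'[symmetric] mult_ac)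
  finally have "ennreal (k / n) * (\<integral>\<^sup>+z. ennreal (indicator (cball 0 \<rho>) z *\<^sub>R s z) \<partial>lborel)
      \<le> ennreal (k / n) * ennreal (M * C)"
    by (simp only: mult.commute[of _ "ennreal (k / n)"])
  moreover have "ennreal (k / n) \<noteq> 0"
    using k n by simp
  ultimately have "(\<integral>\<^sup>+z. ennreal (indicator (cball 0 \<rho>) z *\<^sub>R s z) \<partial>lborel) \<le> ennreal (M * C)"
    using ennreal_mult_le_mult_iff[of "ennreal (k / n)"] by simp
  then have sint: "(LINT z:cball 0 \<rho>|lborel. s z) \<le> M * C"
    unfolding set_lebesgue_integral_def
  proof (subst integral_eq_nn_integral)
    show "AE z in lborel. 0 \<le> indicator (cball 0 \<rho>) z *\<^sub>R s z"
      by (simp add: s_def)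
  qed (use M C in \<open>auto intro!: enn2real_leI simp del: real_scaleR_def\<close>)
  have ints: "set_integrable lborel (cball 0 \<rho>) s"
    unfolding set_integrable_def s_def using contg by (intro borel_integrable_compact continuous_intros) auto
  have intc: "set_integrable lborel (cball (0::complex) \<rho>) (\<lambda>z. ln 2 :: real)"
    unfolding set_integrable_def by (intro borel_integrable_compact continuous_intros) auto
  have intm: "set_integrable lborel (cball 0 \<rho>) (\<lambda>z. max 0 (- Re (g z)))"
    unfolding set_integrable_def using contg by (intro borel_integrable_compact continuous_intros) auto
  \<comment> \<open>The part of the depth above level \<open>- ln 2\<close> costs at most
    \<open>ln 2\<close> per unit area; the rest is \<open>s\<close>.\<close>
  have "(LINT z:cball 0 \<rho>|lborel. max 0 (- Re (g z))) \<le> (LINT z:cball 0 \<rho>|lborel. ln 2 + s z)"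
    using ints intc by (intro set_integral_mono intm set_integral_add) (auto simp: s_def)
  also have "\<dots> = pi * \<rho>\<^sup>2 * ln 2 + (LINT z:cball 0 \<rho>|lborel. s z)"
  proof -
    have "(LINT z:cball (0::complex) \<rho>|lborel. ln 2 :: real) = pi * \<rho>\<^sup>2 * ln 2"
      using \<rho> by (simp add: set_lebesgue_integral_def content_cball eval_unit_ball_vol power2_eq_square)
    then show ?thesis using set_integral_add(2)[OF intc ints] by simp
  qed
  finally show ?thesis using sint by simp
qed

section \<open>Local upper bounds for monic polynomials with zeros in the disc\<close>

text \<open>For \<open>norm z < 1\<close> each factor has positive real part, so principal
  logarithms of the factors are holomorphic and their sum is a logarithm of the whole
  product.\<close>

lemma log_of_linear_product:
  fixes b :: "'i \<Rightarrow> complex"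
  assumes b: "\<And>i. i \<in> I \<Longrightarrow> norm (b i) \<le> 1" and fin: "finite I"
  defines "g \<equiv> \<lambda>z. \<Sum>i\<in>I. Ln (1 - b i * z)"
  shows "g holomorphic_on ball 0 1"
    and "norm z < 1 \<Longrightarrow> exp (g z) = (\<Prod>i\<in>I. 1 - b i * z)"
    and "norm z < 1 \<Longrightarrow> exp (Re (g z)) = (\<Prod>i\<in>I. norm (1 - b i * z))"
proof -
  have lt: "norm (b i * z) < 1" if "i \<in> I" "norm z < 1" for i z
    using mult_right_mono[OF b[OF that(1)], of "norm z"] that(2) by (simp add: norm_mult)
  have "1 - b i * z \<notin> \<real>\<^sub>\<le>\<^sub>0" if "i \<in> I" "norm z < 1" for i z
    using lt[OF that] complex_Re_le_cmod[of "b i * z"] by (auto simp: complex_nonpos_Reals_iff)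
  then show "g holomorphic_on ball 0 1"
    unfolding g_def by (intro holomorphic_intros) auto
  assume z: "norm z < 1"
  have "1 - b i * z \<noteq> 0" if "i \<in> I" for i
    using lt[OF that z] by auto
  then show *: "exp (g z) = (\<Prod>i\<in>I. 1 - b i * z)"
    unfolding g_def exp_sum[OF fin] by (intro prod.cong) auto
  show "exp (Re (g z)) = (\<Prod>i\<in>I. norm (1 - b i * z))"
    using arg_cong[OF *, of norm] by (simp add: prod_norm)
qed

text \<open>The mean value over the small disc around \<open>z\<close> bounds
  \<open>Re (g z)\<close> by the integral of the positive part over the large disc. Since
  \<open>Re g\<close> has mean zero there, this equals the integral of the negative part.\<close>

lemma Re_le_integral_neg_part:
  assumes g: "g holomorphic_on ball 0 S" and g0: "Re (g 0) = 0"
    and z: "norm z \<le> r" and d: "0 < d" "r + d < S"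
  shows "pi * d\<^sup>2 * Re (g z) \<le> (LINT w:cball 0 (r + d)|lborel. max 0 (- Re (g w)))"
proof -
  have r: "0 \<le> r" using z norm_ge_zero[of z] by linarith
  have cont: "continuous_on (cball 0 (r + d)) g"
    using d by (intro holomorphic_on_imp_continuous_on holomorphic_on_subset[OF g]) auto
  have sub: "cball z d \<subseteq> cball 0 (r + d)"
    using z by (simp add: cball_subset_cball_iff dist_norm)
  have int: "set_integrable lborel K f"
    if "compact K" "K \<subseteq> cball 0 (r + d)" "continuous_on (cball 0 (r + d)) f"
    for f :: "complex \<Rightarrow> 'b::{banach, second_countable_topology}" and K
    unfolding set_integrable_def
    using that by (intro borel_integrable_compact) (auto intro: continuous_on_subset)
  have Re_int: "(LINT w:K|lborel. Re (g w)) = Re (LINT w:K|lborel. g w)"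
    if "compact K" "K \<subseteq> cball 0 (r + d)" for K
    using integral_Re[of lborel "\<lambda>w. indicator K w *\<^sub>R g w"] int[OF that cont]
    by (simp add: set_lebesgue_integral_def set_integrable_def)
  have m1: "(LINT w:cball z d|lborel. Re (g w)) = pi * d\<^sup>2 * Re (g z)"
  proof -
    have "g holomorphic_on ball z (S - r)"
      using z by (intro holomorphic_on_subset[OF g]) (simp add: ball_subset_ball_iff dist_norm)
    then show ?thesis
      using holomorphic_mean_value_cball[of g z "S - r" d] d Re_int[OF _ sub]
      by (simp flip: of_real_mult of_real_power)
  qed
  have m2: "(LINT w:cball 0 (r + d)|lborel. Re (g w)) = 0"
    using holomorphic_mean_value_cball[OF g, of "r + d"] d r g0 Re_int[of "cball 0 (r + d)"]
    by (simp flip: of_real_mult of_real_power of_real_add)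
  have "(LINT w:cball z d|lborel. Re (g w)) \<le> (LINT w:cball z d|lborel. max 0 (Re (g w)))"
    using sub cont by (intro set_integral_mono int continuous_intros) auto
  also have "\<dots> \<le> (LINT w:cball 0 (r + d)|lborel. max 0 (Re (g w)))"
    unfolding set_lebesgue_integral_def
  proof (rule integral_mono)
    have contm: "continuous_on (cball 0 (r + d)) (\<lambda>w. max 0 (Re (g w)))"
      using cont by (intro continuous_intros)
    show "integrable lborel (\<lambda>w. indicator (cball z d) w *\<^sub>R max 0 (Re (g w)))"
      using int[OF compact_cball sub contm] by (simp add: set_integrable_def)
    show "integrable lborel (\<lambda>w. indicator (cball 0 (r + d)) w *\<^sub>R max 0 (Re (g w)))"
      using int[OF compact_cball order_refl contm] by (simp add: set_integrable_def)
    show "indicator (cball z d) w *\<^sub>R max 0 (Re (g w))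
        \<le> indicator (cball 0 (r + d)) w *\<^sub>R max 0 (Re (g w))" for w
      using sub by (auto simp: indicator_def)
  qed
  also have "\<dots> = (LINT w:cball 0 (r + d)|lborel. Re (g w) + max 0 (- Re (g w)))"
    unfolding set_lebesgue_integral_def by (intro Bochner_Integration.integral_cong) auto
  also have "\<dots> = (LINT w:cball 0 (r + d)|lborel. Re (g w)) + (LINT w:cball 0 (r + d)|lborel. max 0 (- Re (g w)))"
    using cont by (intro set_integral_add int continuous_intros) auto
  finally show ?thesis
    using m1 m2 by simp
qed

lemma lemniscate_borel: "lemniscate p t \<in> sets borel"
  unfolding lemniscate_def by (auto intro!: borel_closed closed_Collect_le continuous_intros)

text \<open>The point is that the bound depends on \<open>r\<close> and \<open>C\<close> only, not
  on \<open>n\<close> or \<open>p\<close>. The radius \<open>\<rho>\<close> lies midway between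
  \<open>r\<close> and \<open>1\<close>, leaving room for discs of radius \<open>\<rho> - r\<close>
  around \<open>z\<close>.\<close>

lemma monic_poly_disc_bound:
  fixes r C :: real
  assumes p: "p \<in> monic_polys (cball 0 1) n" and n: "n \<ge> 1" and C: "0 \<le> C"
    and area: "emeasure lborel (lemniscate p (1 / 2)) \<le> ennreal (C / n)"
    and z: "norm z \<le> r" and r: "r < 1"
  defines "\<rho> \<equiv> (1 + r) / 2"
  shows "norm (poly p z) \<le> exp ((pi * \<rho>\<^sup>2 * ln 2 + - ln (1 - \<rho>) * C) / (pi * (\<rho> - r)\<^sup>2))"
proof -
  have r0: "0 \<le> r" using z norm_ge_zero[of z] by linarith
  have \<rho>: "0 < \<rho>" "\<rho> < 1" "r < \<rho>" using r r0 by (auto simp: \<rho>_def)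
  obtain a where "smult (lead_coeff p) (\<Prod>i<degree p. [:- a i, 1:]) = p"
    using complex_poly_decompose'[of p] by blast
  then have pa: "p = (\<Prod>i<n. [:- a i, 1:])"
    using p by (auto simp: monic_polys_def)
  have a: "norm (cnj (a i)) \<le> 1" if "i \<in> {..<n}" for i
  proof -
    have "poly p (a i) = 0" using that by (auto simp: pa poly_prod)
    then show ?thesis using p by (auto simp: monic_polys_def)
  qed
  define g where "g = (\<lambda>z. \<Sum>i<n. Ln (1 - cnj (a i) * z))"
  have g: "g holomorphic_on ball 0 1"
    unfolding g_def by (rule log_of_linear_product[OF a]) auto
  have exp_g: "exp (Re (g z)) = (\<Prod>i<n. norm (1 - cnj (a i) * z))" if "norm z < 1" for z
    unfolding g_def by (rule log_of_linear_product[OF a]) (use that in auto)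
  have p_le: "norm (poly p w) \<le> exp (Re (g w))" if "norm w < 1" for w
    unfolding exp_g[OF that] pa poly_prod prod_norm[symmetric]
    using norm_diff_le_norm_one_minus_cnj_mult[of "a _" w] a that
    by (intro prod_mono) (auto simp: norm_minus_commute)
  have growth: "Re (g (t *\<^sub>R w)) \<le> Re (g w) + n * ln t" if t: "1 \<le> t" "norm (t *\<^sub>R w) < 1" for t w
  proof -
    have "norm w \<le> t * norm w" using mult_right_mono[OF t(1), of "norm w"] by simp
    then have w: "norm w < 1" using t by simp
    have "exp (Re (g (t *\<^sub>R w))) = (\<Prod>i<n. norm (1 - t *\<^sub>R (cnj (a i) * w)))"
      unfolding exp_g[OF t(2)] by simp
    also have "\<dots> \<le> (\<Prod>i<n. t * norm (1 - cnj (a i) * w))"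
    proof (intro prod_mono conjI norm_one_minus_scaleR_le t(1) norm_ge_zero)
      fix i assume "i \<in> {..<n}"
      then show "norm (t *\<^sub>R (cnj (a i) * w)) \<le> 1"
        using t mult_mono[OF a[of i], of "norm (t *\<^sub>R w)" 1] by (simp add: norm_mult mult_ac)
    qed
    also have "\<dots> = t ^ n * exp (Re (g w))"
      by (simp add: prod.distrib exp_g[OF w])
    also have "\<dots> = exp (Re (g w) + n * ln t)"
      using t by (simp add: exp_add exp_of_nat_mult)
    finally show ?thesis by simp
  qed
  \<comment> \<open>Each of the \<open>n\<close> factors has modulus at least
    \<open>1 - \<rho>\<close>; this is where the constant \<open>M = - ln (1 - \<rho>)\<close> comes
    from.\<close>
  have lower: "- (n * - ln (1 - \<rho>)) \<le> Re (g w)" if w: "norm w \<le> \<rho>" for w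
  proof -
    have "exp (- (n * - ln (1 - \<rho>))) = (\<Prod>i<n. 1 - \<rho>)"
      using \<rho> by (simp add: exp_of_nat_mult)
    also have "\<dots> \<le> (\<Prod>i<n. norm (1 - cnj (a i) * w))"
    proof (intro prod_mono conjI)
      fix i assume "i \<in> {..<n}"
      then have "norm (cnj (a i) * w) \<le> \<rho>"
        using mult_mono[OF a[of i] w] by (simp add: norm_mult)
      then show "1 - \<rho> \<le> norm (1 - cnj (a i) * w)"
        using norm_triangle_ineq2[of 1 "cnj (a i) * w"] by simp
    qed (use \<rho> in auto)
    finally have "exp (- (n * - ln (1 - \<rho>))) \<le> exp (Re (g w))" using exp_g[of w] w \<rho> by simp
    then show ?thesis by (simp only: exp_le_cancel_iff)
  qed
  \<comment> \<open>The level \<open>1 / 2\<close> of \<open>p\<close> corresponds to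
    \<open>- ln 2\<close> for \<open>Re g\<close>, and \<open>p_le\<close> gives the
    inclusion.\<close>
  have "{w \<in> ball 0 1. Re (g w) \<le> - ln 2} \<subseteq> lemniscate p (1 / 2)"
  proof
    fix w assume "w \<in> {w \<in> ball 0 1. Re (g w) \<le> - ln 2}"
    then have "norm w < 1" "exp (Re (g w)) \<le> exp (- ln 2)" by auto
    then show "w \<in> lemniscate p (1 / 2)"
      using p_le[of w] by (simp add: lemniscate_def exp_minus inverse_eq_divide)
  qed
  moreover have "lemniscate p (1 / 2) \<in> sets lborel"
    by (simp add: lemniscate_borel)
  ultimately have "emeasure lborel {w \<in> ball 0 1. Re (g w) \<le> - ln 2} \<le> ennreal (C / n)"
    using area by (meson emeasure_mono order_trans)
  then have "(LINT w:cball 0 \<rho>|lborel. max 0 (- Re (g w))) \<le> pi * \<rho>\<^sup>2 * ln 2 + - ln (1 - \<rho>) * C"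
    using \<rho> by (intro integral_neg_part_le[OF g n _ _ growth lower _ C]) (auto simp: ln_less_zero)
  moreover have "pi * (\<rho> - r)\<^sup>2 * Re (g z) \<le> (LINT w:cball 0 (r + (\<rho> - r))|lborel. max 0 (- Re (g w)))"
    using \<rho> z by (intro Re_le_integral_neg_part[OF g]) (auto simp: g_def)
  ultimately have "pi * (\<rho> - r)\<^sup>2 * Re (g z) \<le> pi * \<rho>\<^sup>2 * ln 2 + - ln (1 - \<rho>) * C" by simp
  then have "Re (g z) \<le> (pi * \<rho>\<^sup>2 * ln 2 + - ln (1 - \<rho>) * C) / (pi * (\<rho> - r)\<^sup>2)"
    using \<rho> by (subst pos_le_divide_eq) (auto simp: mult_ac)
  then show ?thesis
    using p_le[of z] z r by (meson exp_le_cancel_iff order_trans order_le_less_trans)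
qed

section \<open>The upper bound for the minimal area\<close>

lemma min_area_le:
  assumes n: "n \<ge> 1"
  shows "min_area (cball 0 1) n (1 / 2) \<le> ennreal (4 * pi / n)"
proof -
  define p :: "complex poly" where "p = monom 1 n - 1"
  have pz: "poly p z = z ^ n - 1" for z by (simp add: p_def poly_monom)
  have deg: "degree p = n"
    using n degree_add_eq_left[of "- 1" "monom 1 n :: complex poly"]
    by (simp add: p_def degree_monom_eq)
  have "p \<in> monic_polys (cball 0 1) n"
  proof -
    have "lead_coeff p = 1" using n by (simp add: deg, simp add: p_def)
    moreover have "norm z \<le> 1" if "poly p z = 0" for z
    proof -
      have "norm z ^ n = 1" using that by (simp add: pz flip: norm_power)
      then show ?thesis using n power_le_one_iff[of "norm z" n] by simp
    qed
    ultimately show ?thesis using deg by (auto simp: monic_polys_def)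
  qed
  then have "min_area (cball 0 1) n (1 / 2) \<le> emeasure lebesgue (lemniscate p (1 / 2))"
    unfolding min_area_def by (rule INF_lower)
  also have "\<dots> \<le> emeasure lebesgue (cball (0::complex) (1 + 1 / n) - ball 0 (1 - 1 / n))"
  proof (rule emeasure_mono)
    show "lemniscate p (1 / 2) \<subseteq> cball 0 (1 + 1 / n) - ball 0 (1 - 1 / n)"
    proof
      fix z assume "z \<in> lemniscate p (1 / 2)"
      then have "norm (z ^ n - 1) \<le> 1 / 2" by (simp add: lemniscate_def pz)
      then have zn: "norm z ^ n \<le> 3 / 2" "1 / 2 \<le> norm z ^ n"
        using norm_triangle_ineq2[of "z ^ n" 1] norm_triangle_ineq2[of 1 "z ^ n"]
        by (auto simp: norm_power norm_minus_commute)
      have "norm z \<le> 1 + 1 / n"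
      proof (rule ccontr)
        assume "\<not> norm z \<le> 1 + 1 / n"
        then have "(1 + 1 / n) ^ n \<le> norm z ^ n" by (intro power_mono) auto
        \<comment> \<open>Bernoulli's inequality gives \<open>norm z ^ n \<ge> 2\<close>, against
          the upper bound \<open>3 / 2\<close>.\<close>
        moreover have "1 + n * (1 / n) \<le> (1 + 1 / n) ^ n" 
          by (rule Bernoulli_inequality) (use order_trans[of "- 1" 0 "1 / real n"] in simp)
        moreover have "n * (1 / n) = (1::real)" using n by simp
        ultimately show False using zn(1) by linarith
      qed
      moreover have "1 - 1 / n \<le> norm z"
      proof (rule ccontr)
        assume "\<not> 1 - 1 / n \<le> norm z"
        then have "norm z ^ n \<le> (1 - 1 / n) ^ n" by (intro power_mono) auto
        also have "\<dots> \<le> exp (- 1 / n) ^ n"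
          using n exp_ge_add_one_self[of "- 1 / n"] by (intro power_mono) auto
        also have "\<dots> = exp (- 1)" using n by (simp flip: exp_of_nat_mult)
        \<comment> \<open>The quadratic Taylor bound gives \<open>exp 1 \<ge> 5 / 2\<close>.\<close>
        also have "\<dots> < 1 / 2"
          using e_less_272 exp_gt_one[of 1] exp_lower_Taylor_quadratic[of 1]
          by (simp add: exp_minus field_simps)
        finally show False using zn by simp
      qed
      ultimately show "z \<in> cball 0 (1 + 1 / n) - ball 0 (1 - 1 / n)" by simp
    qed
  qed auto
  also have "\<dots> = emeasure lborel (cball (0::complex) (1 + 1 / n)) - emeasure lborel (ball (0::complex) (1 - 1 / n))"
  proof -
    have "1 - 1 / real n \<le> 1 + 1 / real n" by simp
    then have "ball (0::complex) (1 - 1 / n) \<subseteq> cball 0 (1 + 1 / n)"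
      by (meson ball_subset_cball order_trans subset_cball)
    then show ?thesis
      using emeasure_lborel_ball_finite[of "0::complex" "1 - 1 / n"]
      by (subst emeasure_Diff) (simp_all add: less_top[symmetric])
  qed
  also have "\<dots> = ennreal (pi * (1 + 1 / n)\<^sup>2) - ennreal (pi * (1 - 1 / n)\<^sup>2)"
    using n by (simp add: emeasure_cball emeasure_ball eval_unit_ball_vol power2_eq_square)
  also have "\<dots> = ennreal (pi * (1 + 1 / n)\<^sup>2 - pi * (1 - 1 / n)\<^sup>2)"
    by (rule ennreal_minus) simp
  also have "pi * (1 + 1 / n)\<^sup>2 - pi * (1 - 1 / n)\<^sup>2 = 4 * pi / n"
    by (simp add: power2_eq_square algebra_simps)
  finally show ?thesis .
qed

section \<open>Normality by Montel's theorem\<close>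

theorem theorem29:
  fixes f :: "nat \<Rightarrow> complex poly"
  assumes "\<And>n. n \<ge> 1 \<Longrightarrow> level_minimizer (cball 0 1) n (1/2) (f n)"
  shows "normal_family_on (ball 0 1) {poly (f n) | n. n \<ge> 1}"
  unfolding normal_family_on_def
proof (intro allI impI)
  fix g :: "nat \<Rightarrow> complex \<Rightarrow> complex"
  assume g: "\<forall>k. g k \<in> {poly (f n) | n. n \<ge> 1}"
  have bounded: "\<exists>B. \<forall>h\<in>{poly (f n) | n. n \<ge> 1}. \<forall>z\<in>K. norm (h z) \<le> B"
    if K: "compact K" "K \<subseteq> ball 0 1" for K
  proof -
    obtain r where r: "r < 1" "\<And>z. z \<in> K \<Longrightarrow> norm z \<le> r"
    proof (cases "K = {}")
      case False
      then obtain w where "w \<in> K" "\<And>z. z \<in> K \<Longrightarrow> norm z \<le> norm w"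
        using continuous_attains_sup[OF K(1) _ continuous_on_norm_id] by blast
      then show ?thesis using that[of "norm w"] K by auto
    qed (use that[of 0] in auto)
    show ?thesis
    proof (intro exI ballI)
      fix h z assume "h \<in> {poly (f n) | n. n \<ge> 1}" and z: "z \<in> K"
      then obtain n where n: "n \<ge> 1" and h: "h = poly (f n)" by blast
      have fn: "f n \<in> monic_polys (cball 0 1) n"
        "emeasure lebesgue (lemniscate (f n) (1 / 2)) \<le> ennreal (4 * pi / n)"
        using assms[OF n] min_area_le[OF n] by (auto simp: level_minimizer_def)
      have "emeasure lborel (lemniscate (f n) (1 / 2)) \<le> ennreal (4 * pi / n)"
        using fn(2) lemniscate_borel by simp
      \<comment> \<open>This is the bound with \<open>C = 4 * pi\<close>. It involves only
        \<open>r\<close>, hence only \<open>K\<close>, so it serves as one \<open>B\<close> for all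
        members of the family and all points of \<open>K\<close>.\<close>
      then show "norm (h z) \<le> exp ((pi * ((1 + r) / 2)\<^sup>2 * ln 2 + - ln (1 - (1 + r) / 2) * (4 * pi))
          / (pi * ((1 + r) / 2 - r)\<^sup>2))"
        unfolding h using r z by (intro monic_poly_disc_bound[OF fn(1) n]) auto
    qed
  qed
  obtain h r where "h holomorphic_on ball 0 1" "strict_mono (r :: nat \<Rightarrow> nat)"
    "\<And>K. \<lbrakk>compact K; K \<subseteq> ball 0 1\<rbrakk> \<Longrightarrow> uniform_limit K (g \<circ> r) h sequentially"
    by (rule Montel[of "ball 0 1" "{poly (f n) | n. n \<ge> 1}" g])
       (use g bounded in \<open>auto intro!: holomorphic_intros\<close>)
  then show "\<exists>r h. strict_mono r \<and> h holomorphic_on ball 0 1 \<and>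
      (\<forall>C. compact C \<and> C \<subseteq> ball 0 1 \<longrightarrow> uniform_limit C (\<lambda>k. g (r k)) h sequentially)"
    by (intro exI[of _ r] exI[of _ h]) (auto simp: o_def)
qed

end
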